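(* Let $d \geq 2$, let $\mathcal{X}, \mathcal{Y} \subset \mathbb{R}^d$ be Borel sets, let $\mu$ be a probability measure on $\mathcal{X}$ that is absolutely continuous with respect to $d$-dimensional Lebesgue measure and satisfies $\int_{\mathcal{X}} \|x\| \, \mu(dx) < \infty$, and let $\nu = \sum_{j=1}^n \nu_j \delta_{y_j}$ be a probability measure on $\mathcal{Y}$, where $n \in \mathbb{N}$, $y_1,\ldots,y_n \in \mathcal{Y}$ are pairwise distinct and $\nu_1,\ldots,\nu_n \in (0,1]$. Let $\Phi \colon \mathbb{R}^n \to \mathbb{R}$, $$\Phi(w) = \sum_{j=1}^n \left( -\nu_j w_j - \int_{\mathrm{Vor}_w(j)} \bigl( \|x - y_j\| - w_j \bigr) \, \mu(dx) \right).$$ Then (a) $\Phi$ is convex; (b) $\Phi$ is continuously differentiable with partial derivatives $$\frac{\partial \Phi}{\partial w_j}(w) = -\nu_j + \mu(\mathrm{Vor}_w(j)), \qquad w \in \mathbb{R}^n,\ 1 \leq j \leq n;$$ (c) $\Phi$ takes a minimum in $\mathbb{R}^n$.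
   Context: $\|\cdot\|$ is the Euclidean norm on $\mathbb{R}^d$ and $\delta_y$ is the Dirac measure at $y$. For a weight vector $w = (w_1,\ldots,w_n) \in \mathbb{R}^n$, the cells of the additively weighted Voronoi tessellation of $\mathcal{X}$ around $y_1,\ldots,y_n$ are $$\mathrm{Vor}_w(j) = \{ x \in \mathcal{X} : \|x-y_j\| - w_j \leq \|x-y_k\| - w_k \text{ for all } k \neq j \}, \qquad j = 1,\ldots,n.$$ *)

theory Defs
  imports "HOL-Probability.Probability"
begin

definition Vor :: "(real ^ 'd) set \<Rightarrow> ('n \<Rightarrow> real ^ 'd) \<Rightarrow> real ^ 'n \<Rightarrow> 'n::finite \<Rightarrow> (real ^ 'd) set"
  where "Vor X y w j =
    {x \<in> X. \<forall>k. k \<noteq> j \<longrightarrow> norm (x - y j) - w $ j \<le> norm (x - y k) - w $ k}"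

definition Phi :: "(real ^ 'd) set \<Rightarrow> (real ^ 'd) measure \<Rightarrow> ('n \<Rightarrow> real) \<Rightarrow> ('n \<Rightarrow> real ^ 'd)
    \<Rightarrow> real ^ 'n \<Rightarrow> real"
  where "Phi X \<mu> p y w =
    (\<Sum>j\<in>(UNIV :: 'n::finite set).
       - p j * w $ j - (LINT x:Vor X y w j|\<mu>. (norm (x - y j) - w $ j)))"

(* Continuity of the derivative refers to the operator norm, hence the type of bounded
   linear maps. *)
definition continuously_differentiable :: "('a::real_normed_vector \<Rightarrow> 'b::real_normed_vector) \<Rightarrow> bool"
  where "continuously_differentiable f \<longleftrightarrow>
    (\<exists>D :: 'a \<Rightarrow> 'a \<Rightarrow>\<^sub>L 'b.
       (\<forall>x. (f has_derivative blinfun_apply (D x)) (at x)) \<and> continuous_on UNIV D)"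

definition has_partial_derivative :: "(real ^ 'n \<Rightarrow> real) \<Rightarrow> 'n::finite \<Rightarrow> real \<Rightarrow> real ^ 'n \<Rightarrow> bool"
  where "has_partial_derivative f j D w \<longleftrightarrow>
    ((\<lambda>t. f (w + t *\<^sub>R axis j 1)) has_real_derivative D) (at 0)"

end

theory Submission
  imports Defs
begin

text \<open>
  Outside a null set of ties, every point \<open>x\<close> lies in exactly one cell, and there the integrand of
  \<open>\<Phi>\<close> is \<open>min\<^sub>j (\<parallel>x - y\<^sub>j\<parallel> - w\<^sub>j)\<close>. As a minimum of affine functions of \<open>w\<close> it has the supergradient
  \<open>- e\<^sub>j\<close>, where \<open>j\<close> is the index of the cell; integrating, \<open>(\<mu>(Vor\<^sub>w(j)) - \<nu>\<^sub>j)\<^sub>j\<close> is a subgradient of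
  \<open>\<Phi>\<close> at \<open>w\<close>. A function with a continuous selection of subgradients is convex and continuously
  differentiable, and the cell masses are continuous by dominated convergence. Finally \<open>\<Phi>\<close> is
  invariant under adding a constant to all weights and, because all \<open>\<nu>\<^sub>j\<close> are positive, large whenever
  the weights are spread widely, so its minimum over a suitable cube is global.
\<close>

section \<open>Level sets of differences of distances\<close>

text \<open>This is where dimension at least two enters: on the real line a level set of a
  difference of distances can contain a half-line.\<close>

lemma negligible_line_through:
  fixes a d :: "'a::euclidean_space"
  assumes "2 \<le> DIM('a)"
  shows "negligible ((+) a ` span {d})"
proof (intro negligible_translation negligible_lowdim)
  have "dim (span {d}) \<le> card {d}"
    unfolding dim_span by (rule dim_le_card') simp
  then show "dim (span {d}) < DIM('a)"
    using assms by simp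
qed

text \<open>
  Along a ray from \<open>b\<close> the squared equation is linear in the parameter, so the level set meets each
  ray at most once, except when \<open>c\<^sup>2 = \<parallel>b - a\<parallel>\<^sup>2\<close>; then it lies on the line through \<open>a\<close> and \<open>b\<close>.
\<close>
lemma negligible_norm_diff_level:
  fixes a b :: "'a::euclidean_space"
  assumes dim: "2 \<le> DIM('a)" and "a \<noteq> b"
  shows "negligible {x. norm (x - a) - norm (x - b) = c}"
proof -
  define d where "d = b - a"
  have d: "d \<noteq> 0" using \<open>a \<noteq> b\<close> by (simp add: d_def)
  let ?S = "{x. norm (x - a) - norm (x - b) = c}"
  \<comment> \<open>With \<open>b\<close> as origin the equation reads
    \<open>norm (d + x) = c + norm x\<close>; squaring cancels the quadratic terms and leaves a left
    side positively homogeneous in \<open>x\<close>.\<close>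
  have key: "2 * (d \<bullet> x - c * norm x) = c\<^sup>2 - (norm d)\<^sup>2" if "b + x \<in> ?S" for x
  proof -
    have "norm (d + x) = c + norm x"
      using that by (simp add: d_def algebra_simps)
    then have "(norm (d + x))\<^sup>2 = (c + norm x)\<^sup>2" by simp
    moreover have "(norm (d + x))\<^sup>2 = (norm d)\<^sup>2 + 2 * (d \<bullet> x) + (norm x)\<^sup>2"
      by (simp add: power2_norm_eq_inner inner_add_left inner_add_right inner_commute)
    ultimately show ?thesis by (simp add: power2_sum algebra_simps)
  qed
  show ?thesis
  proof (cases "c\<^sup>2 = (norm d)\<^sup>2")
    case True
    then have c: "\<bar>c\<bar> = norm d" by (metis abs_norm_cancel power2_eq_iff abs_eq_iff)
    have "?S \<subseteq> (+) b ` span {d}"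
    proof
      fix z assume z: "z \<in> ?S"
      \<comment> \<open>As \<open>c\<close> has absolute value \<open>norm d\<close>, this is the
        equality case of Cauchy-Schwarz.\<close>
      have "d \<bullet> (z - b) = c * norm (z - b)"
        using key[of "z - b"] z True by simp
      then have "\<bar>d \<bullet> (z - b)\<bar> = norm d * norm (z - b)"
        by (simp add: abs_mult c)
      then have "collinear {0, d, z - b}"
        by (simp add: norm_cauchy_schwarz_equal)
      then have "\<exists>k. z - b = k *\<^sub>R d"
        using d unfolding collinear_lemma by (auto intro: exI[of _ 0])
      then have "z - b \<in> span {d}"
        by (auto simp: span_singleton)
      then show "z \<in> (+) b ` span {d}"
        by (intro image_eqI[of _ _ "z - b"]) auto
    qed
    with negligible_line_through[OF dim] show ?thesis
      by (rule negligible_subset)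
  next
    case False
    show ?thesis
    proof (rule starlike_negligible[of _ b])
      show "closed ?S"
        by (intro closed_Collect_eq continuous_intros)
      fix t x assume t: "b + t *\<^sub>R x \<in> ?S" "0 \<le> t" "b + x \<in> ?S"
      have "t * (2 * (d \<bullet> x - c * norm x)) = c\<^sup>2 - (norm d)\<^sup>2"
        using key[OF t(1)] t(2) by (simp add: algebra_simps)
      with key[OF t(3)] have "t * (c\<^sup>2 - (norm d)\<^sup>2) = c\<^sup>2 - (norm d)\<^sup>2" by simp
      with False show "t = 1" by simp
    qed
  qed
qed

section \<open>Continuous selections of subgradients\<close>

text \<open>The affine minorant touching \<open>f\<close> at the intermediate point lies below
  \<open>f\<close> at both ends; in the weighted average its linear part cancels.\<close>

lemma convex_on_subgradient:
  fixes f :: "'a::real_inner \<Rightarrow> real"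
  assumes sub: "\<And>w v. f w + g w \<bullet> (v - w) \<le> f v"
  shows "convex_on UNIV f"
proof (rule convex_onI)
  fix t :: real and x y :: 'a
  assume t: "0 < t" "t < 1"
  define z where "z = (1 - t) *\<^sub>R x + t *\<^sub>R y"
  have "(1 - t) * (f z + g z \<bullet> (x - z)) + t * (f z + g z \<bullet> (y - z)) \<le> (1 - t) * f x + t * f y"
    using t by (intro add_mono mult_left_mono sub) auto
  moreover have "(1 - t) * (f z + g z \<bullet> (x - z)) + t * (f z + g z \<bullet> (y - z))
      = f z + g z \<bullet> ((1 - t) *\<^sub>R x + t *\<^sub>R y - z)"
    by (simp add: algebra_simps inner_add_right inner_diff_right)
  ultimately show "f ((1 - t) *\<^sub>R x + t *\<^sub>R y) \<le> (1 - t) * f x + t * f y"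
    by (simp add: z_def)
qed auto

text \<open>The subgradient inequalities at \<open>w\<close> and at \<open>v\<close> squeeze the
  remainder between 0 and the inner product of \<open>g v - g w\<close> with
  \<open>v - w\<close>.\<close>

lemma has_derivative_continuous_subgradient:
  fixes f :: "'a::real_inner \<Rightarrow> real"
  assumes sub: "\<And>w v. f w + g w \<bullet> (v - w) \<le> f v"
    and cont: "isCont g w"
  shows "(f has_derivative (\<bullet>) (g w)) (at w)"
proof (rule has_derivativeI_sandwich[of 1])
  show "bounded_linear ((\<bullet>) (g w))"
    by (rule bounded_linear_inner_right)
  show "((\<lambda>v. norm (g v - g w)) \<longlongrightarrow> 0) (at w)"
    using cont by (simp add: isCont_def tendsto_norm_zero LIM_zero)
  fix v assume "v \<noteq> w"
  have "\<bar>f v - f w - g w \<bullet> (v - w)\<bar> \<le> (g v - g w) \<bullet> (v - w)"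
    using sub[of w v] sub[of v w] by (simp add: algebra_simps inner_diff_left inner_diff_right)
  also have "\<dots> \<le> norm (g v - g w) * norm (v - w)"
    by (rule norm_cauchy_schwarz)
  finally show "norm (f v - f w - g w \<bullet> (v - w)) / norm (v - w) \<le> norm (g v - g w)"
    using \<open>v \<noteq> w\<close> by (simp add: divide_le_eq)
qed simp

section \<open>The dual functional of semidiscrete transport\<close>

locale semidiscrete = prob_space \<mu>
  for \<mu> :: "(real ^ 'd) measure" +
  fixes X :: "(real ^ 'd) set" and y :: "'n::finite \<Rightarrow> real ^ 'd" and p :: "'n \<Rightarrow> real"
  assumes dim: "2 \<le> CARD('d)"
    and X: "X \<in> sets borel"
    and sets_mu: "sets \<mu> = sets (restrict_space borel X)"
    and ac: "absolutely_continuous (restrict_space lborel X) \<mu>"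
    and moment: "integrable \<mu> norm"
    and inj_y: "inj y"
    and p_pos: "\<And>j. 0 < p j"
    and sum_p: "(\<Sum>j\<in>UNIV. p j) = 1"
begin

abbreviation "V \<equiv> Vor X y"

abbreviation "\<Psi> \<equiv> Phi X \<mu> p y"

text \<open>Off the ties this is the minimum over \<open>j\<close> of
  \<open>norm (x - y j) - w $ j\<close>. The form as a sum over cells makes \<open>Phi_eq\<close>
  exact, ties included.\<close>

definition min_cost :: "real ^ 'n \<Rightarrow> real ^ 'd \<Rightarrow> real"
  where "min_cost w x = (\<Sum>j\<in>UNIV. indicator (V w j) x * (norm (x - y j) - w $ j))"

definition grad :: "real ^ 'n \<Rightarrow> real ^ 'n"
  where "grad w = (\<chi> j. - p j + prob (V w j))"

section \<open>Measurability and integrability\<close>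

lemma space_mu: "space \<mu> = X"
  using sets_eq_imp_space_eq[OF sets_mu] by (simp add: space_restrict_space)

lemma borel_measurable_mu: "f \<in> borel_measurable borel \<Longrightarrow> f \<in> borel_measurable \<mu>"
  using measurable_restrict_space1[of f borel borel X] measurable_cong_sets[OF sets_mu refl]
  by blast

lemma measurable_dist_y [measurable]: "(\<lambda>x. norm (x - y j)) \<in> borel_measurable \<mu>"
  by (intro borel_measurable_mu) simp

lemma sets_Vor [measurable]: "V w j \<in> sets \<mu>"
proof -
  have "V w j = {x \<in> space \<mu>. \<forall>k. k \<noteq> j \<longrightarrow> norm (x - y j) - w $ j \<le> norm (x - y k) - w $ k}"
    by (simp add: Vor_def space_mu)
  also have "\<dots> \<in> sets \<mu>"
    by measurable
  finally show ?thesis .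
qed

lemma integrable_indicator_Vor: "integrable \<mu> (indicator (V w j) :: _ \<Rightarrow> real)"
  using sets_Vor emeasure_finite by (intro integrable_real_indicator) (auto simp: less_top[symmetric])

lemma integrable_dist_y: "integrable \<mu> (\<lambda>x. norm (x - y j))"
proof (rule Bochner_Integration.integrable_bound)
  show "integrable \<mu> (\<lambda>x. norm x + norm (y j))"
    using moment by (intro Bochner_Integration.integrable_add) auto
  show "AE x in \<mu>. norm (norm (x - y j)) \<le> norm (norm x + norm (y j))"
    by (auto intro: norm_triangle_ineq4)
qed simp

section \<open>Ties and strict cells\<close>

lemma AE_not_level:
  assumes "j \<noteq> k"
  shows "AE x in \<mu>. norm (x - y j) - norm (x - y k) \<noteq> c"
proof -
  define N where "N = {x. norm (x - y j) - norm (x - y k) = c}"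
  have "negligible N"
    unfolding N_def using dim assms inj_y
    by (intro negligible_norm_diff_level) (auto dest: injD)
  \<comment> \<open>\<open>negligible\<close> refers to the completed Lebesgue measure; Borel
    measurability of \<open>N\<close> brings the statement back to \<open>lborel\<close>.\<close>
  moreover have N: "N \<in> sets borel"
    unfolding N_def by (intro borel_closed closed_Collect_eq continuous_intros)
  ultimately have "N \<in> null_sets lborel"
    by (simp add: negligible_iff_null_sets null_sets_completion_iff)
  then have "N \<inter> X \<in> null_sets lborel"
    using X by (intro null_set_Int2) auto
  then have "N \<inter> X \<in> null_sets \<mu>"
    using ac X by (auto simp: absolutely_continuous_def null_sets_restrict_space)
  then show ?thesis
    by (rule AE_I') (auto simp: N_def space_mu)
qed

text \<open>Strictness makes the index unique and keeps it unchanged under small perturbations of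
  \<open>w\<close>.\<close>

definition strict_cell :: "real ^ 'n \<Rightarrow> real ^ 'd \<Rightarrow> 'n \<Rightarrow> bool"
  where "strict_cell w x j \<longleftrightarrow>
    x \<in> X \<and> (\<forall>k. k \<noteq> j \<longrightarrow> norm (x - y j) - w $ j < norm (x - y k) - w $ k)"

text \<open>A minimal index exists by finiteness; off the finitely many tie sets it is strictly
  minimal.\<close>

lemma AE_strict_cell: "AE x in \<mu>. \<exists>j. strict_cell w x j"
proof -
  have "AE x in \<mu>. \<forall>j k. j \<noteq> k \<longrightarrow> norm (x - y j) - norm (x - y k) \<noteq> w $ j - w $ k"
    using AE_not_level by (simp add: AE_all_countable)
  with AE_space show ?thesis
  proof eventually_elim
    case (elim x)
    let ?c = "\<lambda>j. norm (x - y j) - w $ j"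
    have "Min (range ?c) \<in> range ?c"
      by (intro Min_in) auto
    then obtain j where "Min (range ?c) = ?c j" by blast
    then have j: "?c j \<le> ?c k" for k
      using Min_le[of "range ?c" "?c k"] by simp
    have "?c j < ?c k" if "k \<noteq> j" for k
    proof -
      have "?c j \<noteq> ?c k"
        using elim(2)[rule_format, of j k] that by (auto simp: algebra_simps)
      with j[of k] show ?thesis by linarith
    qed
    then show ?case
      using elim(1) by (auto simp: strict_cell_def space_mu)
  qed
qed

lemma strict_cell_iff:
  assumes "strict_cell w x j"
  shows "x \<in> V w k \<longleftrightarrow> k = j"
proof
  assume "x \<in> V w k"
  show "k = j"
  proof (rule ccontr)
    assume "k \<noteq> j"
    then have "norm (x - y k) - w $ k \<le> norm (x - y j) - w $ j"
      "norm (x - y j) - w $ j < norm (x - y k) - w $ k"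
      using assms \<open>x \<in> V w k\<close> by (auto simp: strict_cell_def Vor_def)
    then show False by simp
  qed
next
  assume "k = j"
  with assms show "x \<in> V w k"
    by (auto simp: strict_cell_def Vor_def intro: less_imp_le)
qed

lemma strict_cell_sum:
  assumes "strict_cell w x j"
  shows "(\<Sum>k\<in>UNIV. indicator (V w k) x * h k) = (h j :: real)"
proof -
  have "(\<Sum>k\<in>UNIV. indicator (V w k) x * h k) = (\<Sum>k\<in>UNIV. if k = j then h k else 0)"
    by (intro sum.cong) (auto simp: strict_cell_iff[OF assms])
  then show ?thesis by simp
qed

lemma strict_cell_min_cost:
  assumes "strict_cell w x j"
  shows "min_cost w x = norm (x - y j) - w $ j" "min_cost w x \<le> norm (x - y k) - w $ k"
proof -
  show *: "min_cost w x = norm (x - y j) - w $ j"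
    unfolding min_cost_def by (rule strict_cell_sum[OF assms])
  show "min_cost w x \<le> norm (x - y k) - w $ k"
    using assms unfolding * strict_cell_def by (cases "k = j") (auto intro: less_imp_le)
qed

section \<open>Integral form of the functional and its subgradient\<close>

lemma integrable_cell: "integrable \<mu> (\<lambda>x. indicator (V w j) x * (norm (x - y j) - w $ j))"
  using integrable_mult_indicator[OF sets_Vor, of "\<lambda>x. norm (x - y j) - w $ j" w j] integrable_dist_y[of j]
  by simp

lemma integrable_min_cost: "integrable \<mu> (min_cost w)"
  unfolding min_cost_def[abs_def] by (intro Bochner_Integration.integrable_sum integrable_cell)

lemma Phi_eq: "\<Psi> w = - (\<Sum>j\<in>UNIV. p j * w $ j) - integral\<^sup>L \<mu> (min_cost w)"
proof -
  have "integral\<^sup>L \<mu> (min_cost w)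
      = (\<Sum>j\<in>UNIV. LINT x|\<mu>. indicator (V w j) x * (norm (x - y j) - w $ j))"
    unfolding min_cost_def[abs_def] by (intro Bochner_Integration.integral_sum integrable_cell)
  then show ?thesis
    by (simp add: Phi_def set_lebesgue_integral_def sum_subtractf sum_negf)
qed

lemma Phi_subgradient: "\<Psi> w + grad w \<bullet> (v - w) \<le> \<Psi> v"
proof -
  \<comment> \<open>For almost every \<open>x\<close>, \<open>?D x\<close> is
    \<open>(v - w) $ j\<close> with \<open>j\<close> the cell index under \<open>w\<close>. The
    competitor \<open>j\<close> then bounds the minimum at \<open>v\<close> by
    \<open>min_cost w x - ?D x\<close>.\<close>
  let ?D = "\<lambda>x. \<Sum>j\<in>UNIV. indicator (V w j) x * (v - w) $ j"
  have int: "integrable \<mu> (\<lambda>x. indicator (V w j) x * (v - w) $ j)" for j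
    by (intro integrable_mult_left integrable_indicator_Vor)
  have "integral\<^sup>L \<mu> (min_cost v) \<le> (LINT x|\<mu>. min_cost w x - ?D x)"
  proof (rule integral_mono_AE)
    show "integrable \<mu> (\<lambda>x. min_cost w x - ?D x)"
      by (intro Bochner_Integration.integrable_diff Bochner_Integration.integrable_sum
          integrable_min_cost int)
    show "AE x in \<mu>. min_cost v x \<le> min_cost w x - ?D x"
      using AE_strict_cell[of v] AE_strict_cell[of w]
    proof eventually_elim
      case (elim x)
      then obtain i j where i: "strict_cell v x i" and j: "strict_cell w x j" by blast
      show ?case
        using strict_cell_min_cost(2)[OF i, of j] strict_cell_min_cost(1)[OF j]
        by (simp add: strict_cell_sum[OF j])
    qed
  qed (rule integrable_min_cost)
  also have "\<dots> = integral\<^sup>L \<mu> (min_cost w) - (LINT x|\<mu>. ?D x)"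
    by (intro Bochner_Integration.integral_diff integrable_min_cost
        Bochner_Integration.integrable_sum int)
  also have "(LINT x|\<mu>. ?D x) = (\<Sum>j\<in>UNIV. prob (V w j) * (v - w) $ j)"
    using sets_Vor by (subst Bochner_Integration.integral_sum[OF int]) simp
  finally show ?thesis
    unfolding Phi_eq grad_def inner_vec_def
    by (simp add: algebra_simps sum.distrib sum_subtractf sum_negf)
qed

lemma sum_prob_Vor: "(\<Sum>j\<in>UNIV. prob (V w j)) = 1"
proof -
  have "(\<Sum>j\<in>UNIV. prob (V w j)) = (LINT x|\<mu>. (\<Sum>j\<in>UNIV. indicator (V w j) x))"
    using sets_Vor by (subst Bochner_Integration.integral_sum) (auto intro: integrable_indicator_Vor)
  also have "\<dots> = (LINT x|\<mu>. 1)"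
  proof (rule integral_cong_AE)
    show "AE x in \<mu>. (\<Sum>j\<in>UNIV. indicator (V w j) x) = (1::real)"
      using AE_strict_cell[of w]
    proof eventually_elim
      case (elim x)
      then show ?case using strict_cell_sum[where h = "\<lambda>_. 1"] by auto
    qed
  qed (use sets_Vor in measurable)
  finally show ?thesis by (simp add: prob_space)
qed

text \<open>Both \<open>p\<close> and the cell masses sum to one, so \<open>grad w\<close> is
  orthogonal to constant vectors. The subgradient inequality for \<open>c\<close> and then for
  \<open>- c\<close> gives both directions.\<close>

lemma Phi_shift: "\<Psi> (\<chi> j. w $ j + c) = \<Psi> w"
proof -
  have "\<Psi> w \<le> \<Psi> (\<chi> j. w $ j + c)" for w c
  proof -
    have "grad w \<bullet> ((\<chi> j. w $ j + c) - w) = (\<Sum>j\<in>UNIV. (prob (V w j) - p j) * c)"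
      by (simp add: inner_vec_def grad_def)
    also have "\<dots> = 0"
      by (simp add: sum_distrib_right[symmetric] sum_subtractf sum_prob_Vor sum_p)
    finally show ?thesis
      using Phi_subgradient[of w "\<chi> j. w $ j + c"] by simp
  qed
  from this[of w c] this[of "\<chi> j. w $ j + c" "- c"] show ?thesis
    by simp
qed

section \<open>Continuity of the cell masses and differentiability\<close>

text \<open>Near a point of strict minimality the cell containing \<open>x\<close> does not change with the weights.\<close>
lemma tendsto_indicator_Vor:
  assumes u: "u \<longlonglongrightarrow> w" and i: "strict_cell w x i"
  shows "(\<lambda>n. indicator (V (u n) j) x) \<longlonglongrightarrow> (indicator (V w j) x :: real)"
proof -
  have "\<forall>\<^sub>F n in sequentially. k \<noteq> i \<longrightarrow>
      norm (x - y i) - u n $ i < norm (x - y k) - u n $ k" for k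
  proof (cases "k = i")
    case False
    have "(\<lambda>n. (norm (x - y k) - u n $ k) - (norm (x - y i) - u n $ i)) \<longlonglongrightarrow>
        (norm (x - y k) - w $ k) - (norm (x - y i) - w $ i)"
      by (intro tendsto_intros u)
    moreover have "0 < (norm (x - y k) - w $ k) - (norm (x - y i) - w $ i)"
      using i False by (simp add: strict_cell_def)
    ultimately have "\<forall>\<^sub>F n in sequentially.
        0 < (norm (x - y k) - u n $ k) - (norm (x - y i) - u n $ i)"
      by (rule order_tendstoD(1))
    then show ?thesis
      by (rule eventually_mono) simp
  qed simp
  then have "\<forall>\<^sub>F n in sequentially. \<forall>k. k \<noteq> i \<longrightarrow>
      norm (x - y i) - u n $ i < norm (x - y k) - u n $ k"
    by (rule eventually_all_finite)
  then have "\<forall>\<^sub>F n in sequentially. indicator (V (u n) j) x = (indicator (V w j) x :: real)"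
  proof eventually_elim
    case (elim n)
    with i have "strict_cell (u n) x i"
      by (simp add: strict_cell_def)
    with i show ?case
      by (simp add: indicator_def strict_cell_iff)
  qed
  then show ?thesis
    by (rule tendsto_eventually)
qed

lemma continuous_on_prob_Vor: "continuous_on UNIV (\<lambda>w. prob (V w j))"
proof (rule continuous_on_sequentiallyI)
  fix u :: "nat \<Rightarrow> real ^ 'n" and w
  assume u: "u \<longlonglongrightarrow> w"
  have "(\<lambda>n. LINT x|\<mu>. indicator (V (u n) j) x :: real) \<longlonglongrightarrow> (LINT x|\<mu>. indicator (V w j) x)"
  proof (rule integral_dominated_convergence[where w = "\<lambda>_. 1"])
    show "AE x in \<mu>. (\<lambda>n. indicator (V (u n) j) x) \<longlonglongrightarrow> (indicator (V w j) x :: real)"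
      using AE_strict_cell[of w] by eventually_elim (auto intro: tendsto_indicator_Vor[OF u])
  qed (use sets_Vor in auto)
  then show "(\<lambda>n. prob (V (u n) j)) \<longlonglongrightarrow> prob (V w j)"
    using sets_Vor by simp
qed

lemma continuous_on_grad: "continuous_on UNIV grad"
  unfolding grad_def[abs_def]
  by (intro continuous_on_vec_lambda continuous_intros continuous_on_prob_Vor)

lemma has_derivative_Phi: "(\<Psi> has_derivative (\<bullet>) (grad w)) (at w)"
  using continuous_on_grad
  by (intro has_derivative_continuous_subgradient Phi_subgradient)
    (simp add: continuous_on_eq_continuous_at)

lemma continuously_differentiable_Phi: "continuously_differentiable \<Psi>"
  unfolding continuously_differentiable_def
proof (intro exI[of _ "\<lambda>w. blinfun_inner_right (grad w)"] conjI allI)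
  \<comment> \<open>A vector depends linearly and boundedly on nothing but itself in the dual:
    operator-norm continuity is inherited from \<open>grad\<close>.\<close>
  show "continuous_on UNIV (\<lambda>w. blinfun_inner_right (grad w))"
    by (intro bounded_linear.continuous_on[OF bounded_linear_blinfun_inner_right] continuous_on_grad)
qed (use has_derivative_Phi in simp)

lemma has_partial_derivative_Phi: "has_partial_derivative \<Psi> j (- p j + prob (V w j)) w"
proof -
  have line: "((\<lambda>t. w + t *\<^sub>R axis j 1) has_derivative (\<lambda>t. t *\<^sub>R axis j 1)) (at 0)"
    by (auto intro!: derivative_eq_intros)
  have "((\<lambda>t. \<Psi> (w + t *\<^sub>R axis j 1)) has_derivative (\<lambda>t. grad w \<bullet> (t *\<^sub>R axis j 1))) (at 0)"
    using has_derivative_Phi[of w] by (intro has_derivative_compose[OF line]) simp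
  moreover have "(\<lambda>t. grad w \<bullet> (t *\<^sub>R axis j 1)) = (*) (- p j + prob (V w j))"
    by (auto simp: inner_axis grad_def)
  ultimately show ?thesis
    by (simp add: has_partial_derivative_def has_field_derivative_def)
qed

section \<open>Coercivity and existence of a minimum\<close>

lemma Phi_lower_bound:
  "(\<Sum>j\<in>UNIV. p j * (w $ m - w $ j)) - (LINT x|\<mu>. norm (x - y m)) \<le> \<Psi> w"
proof -
  \<comment> \<open>Sending all mass to the single site \<open>m\<close> can only raise the cost;
    \<open>sum_p\<close> later turns \<open>w $ m\<close> into a \<open>p\<close>-average.\<close>
  have "integral\<^sup>L \<mu> (min_cost w) \<le> (LINT x|\<mu>. norm (x - y m) - w $ m)"
  proof (rule integral_mono_AE)
    show "AE x in \<mu>. min_cost w x \<le> norm (x - y m) - w $ m"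
      using AE_strict_cell[of w] by eventually_elim (auto intro: strict_cell_min_cost(2))
  qed (simp_all add: integrable_min_cost integrable_dist_y)
  also have "\<dots> = (LINT x|\<mu>. norm (x - y m)) - w $ m"
    by (simp add: integrable_dist_y prob_space)
  finally show ?thesis
    by (simp add: Phi_eq right_diff_distrib sum_subtractf sum_distrib_right[symmetric] sum_p)
qed

text \<open>By \<open>Phi_shift\<close> growth can only be expected in the spread of the weights.
  With \<open>m\<close> of largest weight all terms of the lower bound are nonnegative, so the term
  of \<open>k\<close> alone suffices.\<close>

lemma Phi_coercive:
  obtains R where "\<And>w m k. (\<And>j. w $ j \<le> w $ m) \<Longrightarrow> R \<le> w $ m - w $ k \<Longrightarrow> B \<le> \<Psi> w"
proof -
  define C where "C = (\<Sum>m\<in>UNIV. LINT x|\<mu>. norm (x - y m))"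
  define q where "q = Min (range p)"
  have q: "0 < q" "q \<le> p k" for k
    using p_pos by (auto simp: q_def)
  have C: "(LINT x|\<mu>. norm (x - y m)) \<le> C" for m
    unfolding C_def by (rule member_le_sum) auto
  show thesis
  proof (rule that)
    fix w :: "real ^ 'n" and m k
    assume max: "\<And>j. w $ j \<le> w $ m" and R: "max 0 ((B + C) / q) \<le> w $ m - w $ k"
    have "(B + C) / q \<le> w $ m - w $ k"
      using R by simp
    then have "B + C \<le> q * (w $ m - w $ k)"
      using q(1) by (simp add: divide_le_eq mult.commute)
    also have "\<dots> \<le> p k * (w $ m - w $ k)"
      using q R by (intro mult_right_mono) auto
    also have "\<dots> \<le> (\<Sum>j\<in>UNIV. p j * (w $ m - w $ j))"
      using max p_pos by (intro member_le_sum) (simp_all add: less_imp_le)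
    also have "\<dots> \<le> \<Psi> w + C"
      using Phi_lower_bound[of w m] C[of m] by simp
    finally show "B \<le> \<Psi> w" by simp
  qed
qed

text \<open>Shifting makes the largest weight 0. A shifted vector outside the cube has spread beyond
  \<open>R\<close>, hence a value at least that at 0, which lies in the cube.\<close>

lemma Phi_attains_min: "\<exists>w\<^sub>0. \<forall>w. \<Psi> w\<^sub>0 \<le> \<Psi> w"
proof -
  obtain R where R: "\<And>w m k. (\<And>j. w $ j \<le> w $ m) \<Longrightarrow> R \<le> w $ m - w $ k \<Longrightarrow> \<Psi> 0 \<le> \<Psi> w"
    using Phi_coercive[of "\<Psi> 0"] by blast
  \<comment> \<open>The sign of \<open>R\<close> is unknown; the absolute value ensures that 0
    belongs to \<open>K\<close>.\<close>
  define K :: "(real ^ 'n) set" where "K = cbox (\<chi> j. - \<bar>R\<bar>) 0"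
  have K: "w \<in> K \<longleftrightarrow> (\<forall>j. - \<bar>R\<bar> \<le> w $ j \<and> w $ j \<le> 0)" for w
    by (simp add: K_def mem_box_cart)
  have "0 \<in> K" by (simp add: K)
  have "continuous_on K \<Psi>"
    by (meson has_derivative_Phi has_derivative_continuous continuous_at_imp_continuous_on)
  then obtain w\<^sub>0 where w0: "\<And>w. w \<in> K \<Longrightarrow> \<Psi> w\<^sub>0 \<le> \<Psi> w"
    using continuous_attains_inf[of K \<Psi>] \<open>0 \<in> K\<close> by (auto simp: K_def)
  have "\<Psi> w\<^sub>0 \<le> \<Psi> w" for w
  proof -
    have "Max (range (($) w)) \<in> range (($) w)"
      by (intro Max_in) auto
    then obtain m where "Max (range (($) w)) = w $ m" by blast
    then have m: "w $ j \<le> w $ m" for j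
      using Max_ge[of "range (($) w)" "w $ j"] by simp
    define v where "v = (\<chi> j. w $ j + (- w $ m))"
    have v: "v $ j \<le> v $ m" "v $ m = 0" for j
      using m by (simp_all add: v_def)
    then have v_nonpos: "v $ j \<le> 0" for j by metis
    have "\<Psi> w\<^sub>0 \<le> \<Psi> v"
    proof (cases "v \<in> K")
      case False
      then obtain k where "v $ k < - \<bar>R\<bar>"
        using v_nonpos by (auto simp: K not_le)
      then have "\<Psi> 0 \<le> \<Psi> v"
        using v by (intro R[of v m k]) auto
      with w0[OF \<open>0 \<in> K\<close>] show ?thesis by simp
    qed (rule w0)
    then show ?thesis
      by (simp only: v_def Phi_shift)
  qed
  then show ?thesis by blast
qed

end


theorem theorem3:
  fixes X Y :: "(real ^ 'd) set"
    and \<mu> \<nu> :: "(real ^ 'd) measure"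
    and y :: "'n::finite \<Rightarrow> real ^ 'd"
    and p :: "'n \<Rightarrow> real"
  assumes dim: "CARD('d) \<ge> 2"
    and X: "X \<in> sets borel"
    and Y: "Y \<in> sets borel"
    and mu_sets: "sets \<mu> = sets (restrict_space borel X)"
    and mu_prob: "prob_space \<mu>"
    and mu_ac: "absolutely_continuous (restrict_space lborel X) \<mu>"
    and mu_moment: "integrable \<mu> (\<lambda>x. norm x)"
    and nu_sets: "sets \<nu> = sets (restrict_space borel Y)"
    and nu_prob: "prob_space \<nu>"
    and y_Y: "\<And>j. y j \<in> Y"
    and y_distinct: "inj y"
    and p_range: "\<And>j. p j \<in> {0<..1}"
    and nu_eq: "\<And>A. A \<in> sets \<nu> \<Longrightarrow>
      emeasure \<nu> A = (\<Sum>j\<in>UNIV. ennreal (p j) * emeasure (return (restrict_space borel Y) (y j)) A)"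
  shows "convex_on UNIV (Phi X \<mu> p y) \<and>
    (continuously_differentiable (Phi X \<mu> p y) \<and>
      (\<forall>w j. has_partial_derivative (Phi X \<mu> p y) j (- p j + measure \<mu> (Vor X y w j)) w)) \<and>
    (\<exists>w\<^sub>0. \<forall>w. Phi X \<mu> p y w\<^sub>0 \<le> Phi X \<mu> p y w)"
proof -
  have space_nu: "space \<nu> = Y"
    using sets_eq_imp_space_eq[OF nu_sets] by (simp add: space_restrict_space)
  \<comment> \<open>Evaluating \<open>nu_eq\<close> on the whole space, where each Dirac measure has
    mass one, yields \<open>sum_p\<close>.\<close>
  have "1 = emeasure \<nu> (space \<nu>)"
    using nu_prob by (simp add: prob_space.emeasure_space_1)
  also have "\<dots> = (\<Sum>j\<in>UNIV. ennreal (p j))"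
    using nu_eq[OF sets.top] y_Y nu_sets[symmetric] sets.top[of \<nu>] by (simp add: space_nu)
  also have "\<dots> = ennreal (\<Sum>j\<in>UNIV. p j)"
    using p_range by (intro sum_ennreal) (auto intro: less_imp_le)
  finally have sum_p: "(\<Sum>j\<in>UNIV. p j) = 1"
    by simp
  interpret prob_space \<mu> by (rule mu_prob)
  interpret semidiscrete \<mu> X y p
    by unfold_locales (use assms sum_p in auto)
  show ?thesis
    using convex_on_subgradient[OF Phi_subgradient] continuously_differentiable_Phi
      has_partial_derivative_Phi Phi_attains_min by blast
qed

end
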